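(* Let $(X,\mu,\mathcal{E},\mathcal{F})$ be a symmetric Dirichlet space and $d$ a metric on $X$ compatible with the topology of $X$, such that $(X,d,\mu)$ is Ahlfors $d_H$-regular and $\{P_t\}_{t>0}$ is conservative and admits a heat kernel satisfying the sub-Gaussian estimates of the context with walk dimension $d_W\in(1,\infty)$. (i) Let $0<\delta<d_H$ and $1\le p<\frac{d_H}{\delta}$. There exists a constant $C_{p,\delta}>0$ such that for every $f\in\mathbf{B}^{p,\delta/d_W}(X)$, \[ \sup_{s\ge0}\,s\,\mu\left(\{x\in X:|f(x)|\ge s\}\right)^{\frac1q}\le C_{p,\delta}\,\sup_{r>0}\frac1{r^{\delta+d_H/p}}\left(\iint_{\Delta_r}|f(x)-f(y)|^p\,d\mu(x)\,d\mu(y)\right)^{1/p}, \] where $q=\frac{pd_H}{d_H-p\delta}$. (ii) For every $0<\delta<d_H$ there exists a constant $C_{\mathrm{iso},\delta}>0$ such that for every measurable $E\subset X$ with $\mu(E)<+\infty$, \[ \mu(E)^{\frac{d_H-\delta}{d_H}}\le C_{\mathrm{iso},\delta}\,\sup_{r>0}\frac1{r^{\delta+d_H}}(\mu\otimes\mu)\left\{(x,y)\in E\times E^c:d(x,y)<r\right\}. \]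
   Context: $\mu$ is a Radon measure on $X$, $\mathcal{E}$ a symmetric Dirichlet form on $L^2(X,\mu)$ with domain $\mathcal{F}$ and semigroup $P_t$; conservative means $P_t1=1$. Balls $B(x,r)=\{y:d(x,y)<r\}$ have compact closure. Ahlfors $d_H$-regular: there are $c_1,c_2,d_H\in(0,\infty)$ with $c_1r^{d_H}\le\mu(B(x,r))\le c_2r^{d_H}$ for all $x\in X$, $r\in(0,\infty)$. Sub-Gaussian heat kernel estimates: for some $c_3,c_4,c_5,c_6\in(0,\infty)$, $d_W\in(1,\infty)$, \[ c_5t^{-d_H/d_W}\exp\left(-c_6\left(\tfrac{d(x,y)^{d_W}}t\right)^{\frac1{d_W-1}}\right)\le p_t(x,y)\le c_3t^{-d_H/d_W}\exp\left(-c_4\left(\tfrac{d(x,y)^{d_W}}t\right)^{\frac1{d_W-1}}\right) \] for $\mu\times\mu$-a.e. $(x,y)$ and each $t\in(0,\infty)$. $\Delta_r=\{(x,y)\in X\times X:d(x,y)<r\}$. For $p\ge1$, $\alpha\ge0$: $\|f\|_{p,\alpha}=\sup_{t>0}t^{-\alpha}\left(\int_X\int_X|f(x)-f(y)|^pp_t(x,y)\,d\mu(x)\,d\mu(y)\right)^{1/p}$ and $\mathbf{B}^{p,\alpha}(X)=\{f\in L^p(X,\mu):\|f\|_{p,\alpha}<\infty\}$. *)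

theory Defs
  imports "HOL-Analysis.Analysis"
begin

text \<open>Real powers of extended nonnegative numbers; only used for exponents \<open>a > 0\<close>,
  where the value at infinity is infinity.\<close>

definition epowr :: "ennreal \<Rightarrow> real \<Rightarrow> ennreal" (infixr "epowr" 80) where
  "x epowr a = (if x = \<infinity> then \<infinity> else ennreal (enn2real x powr a))"

definition radon_measure :: "'a::topological_space measure \<Rightarrow> bool" where
  "radon_measure M \<longleftrightarrow>
     sets M = sets borel \<and>
     (\<forall>K. compact K \<longrightarrow> emeasure M K < \<infinity>) \<and>
     (\<forall>A\<in>sets M. emeasure M A = (INF U\<in>{U. open U \<and> A \<subseteq> U}. emeasure M U)) \<and>
     (\<forall>U. open U \<longrightarrow> emeasure M U = (SUP K\<in>{K. compact K \<and> K \<subseteq> U}. emeasure M K))"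


text \<open>Elements of \<open>L\<^sup>p\<close> are represented by real-valued functions rather than by their
  almost-everywhere classes; every notion below is made invariant under almost-everywhere
  equality.\<close>

definition Lp :: "'a measure \<Rightarrow> real \<Rightarrow> ('a \<Rightarrow> real) set" where
  "Lp M p = {f \<in> borel_measurable M. integrable M (\<lambda>x. \<bar>f x\<bar> powr p)}"

definition L2_inner :: "'a measure \<Rightarrow> ('a \<Rightarrow> real) \<Rightarrow> ('a \<Rightarrow> real) \<Rightarrow> real" where
  "L2_inner M f g = (\<integral>x. f x * g x \<partial>M)"

definition L2_norm :: "'a measure \<Rightarrow> ('a \<Rightarrow> real) \<Rightarrow> real" where
  "L2_norm M f = sqrt (L2_inner M f f)"


text \<open>A symmetric Dirichlet form with domain \<open>F\<close>: a densely defined, closed, nonnegative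
  symmetric bilinear form on \<open>L\<^sup>2\<close> on which the unit contraction operates. The values of
  \<open>\<E>\<close> outside \<open>F\<close> are irrelevant.\<close>

definition form_norm_sq ::
  "'a measure \<Rightarrow> (('a \<Rightarrow> real) \<Rightarrow> ('a \<Rightarrow> real) \<Rightarrow> real) \<Rightarrow> ('a \<Rightarrow> real) \<Rightarrow> real" where
  "form_norm_sq M \<E> f = \<E> f f + L2_inner M f f"

definition symmetric_dirichlet_form ::
  "'a measure \<Rightarrow> (('a \<Rightarrow> real) \<Rightarrow> ('a \<Rightarrow> real) \<Rightarrow> real) \<Rightarrow> ('a \<Rightarrow> real) set \<Rightarrow> bool" where
  "symmetric_dirichlet_form M \<E> F \<longleftrightarrow>
     \<comment> \<open>\<open>F\<close> is a dense linear subspace of \<open>L\<^sup>2\<close>, and \<open>(\<E>, F)\<close> respects a.e. classes\<close>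
     F \<subseteq> Lp M 2 \<and>
     (\<forall>f\<in>F. \<forall>g\<in>F. (\<lambda>x. f x + g x) \<in> F) \<and>
     (\<forall>f\<in>F. \<forall>c. (\<lambda>x. c * f x) \<in> F) \<and>
     (\<forall>f\<in>Lp M 2. \<forall>e>0. \<exists>g\<in>F. L2_norm M (\<lambda>x. f x - g x) < e) \<and>
     (\<forall>f\<in>F. \<forall>g\<in>borel_measurable M. (AE x in M. f x = g x) \<longrightarrow>
        g \<in> F \<and> (\<forall>h\<in>F. \<E> f h = \<E> g h)) \<and>
     \<comment> \<open>nonnegative symmetric bilinear form\<close>
     (\<forall>f\<in>F. \<forall>g\<in>F. \<E> f g = \<E> g f) \<and>
     (\<forall>f\<in>F. \<forall>g\<in>F. \<forall>h\<in>F. \<E> (\<lambda>x. f x + g x) h = \<E> f h + \<E> g h) \<and>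
     (\<forall>f\<in>F. \<forall>h\<in>F. \<forall>c. \<E> (\<lambda>x. c * f x) h = c * \<E> f h) \<and>
     (\<forall>f\<in>F. 0 \<le> \<E> f f) \<and>
     \<comment> \<open>closedness\<close>
     (\<forall>u. (\<forall>n::nat. u n \<in> F) \<and>
          (\<forall>e>0. \<exists>N. \<forall>m\<ge>N. \<forall>n\<ge>N. form_norm_sq M \<E> (\<lambda>x. u m x - u n x) < e) \<longrightarrow>
          (\<exists>v\<in>F. (\<lambda>n. form_norm_sq M \<E> (\<lambda>x. u n x - v x)) \<longlonglongrightarrow> 0)) \<and>
     \<comment> \<open>Markov property\<close>
     (\<forall>f\<in>F. (\<lambda>x. min (max (f x) 0) 1) \<in> F \<and>
        \<E> (\<lambda>x. min (max (f x) 0) 1) (\<lambda>x. min (max (f x) 0) 1) \<le> \<E> f f)"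


text \<open>Strongly continuous contraction semigroups of symmetric operators on \<open>L\<^sup>2\<close>. Only the values
  \<open>P t f\<close> with \<open>t > 0\<close> and \<open>f\<close> in \<open>L\<^sup>2\<close> matter.\<close>

definition L2_semigroup :: "'a measure \<Rightarrow> (real \<Rightarrow> ('a \<Rightarrow> real) \<Rightarrow> 'a \<Rightarrow> real) \<Rightarrow> bool" where
  "L2_semigroup M P \<longleftrightarrow>
     (\<forall>t>0. \<forall>f\<in>Lp M 2. P t f \<in> Lp M 2) \<and>
     (\<forall>t>0. \<forall>f\<in>Lp M 2. \<forall>g\<in>Lp M 2. (AE x in M. f x = g x) \<longrightarrow> (AE x in M. P t f x = P t g x)) \<and>
     (\<forall>t>0. \<forall>f\<in>Lp M 2. \<forall>g\<in>Lp M 2. AE x in M. P t (\<lambda>y. f y + g y) x = P t f x + P t g x) \<and>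
     (\<forall>t>0. \<forall>f\<in>Lp M 2. \<forall>c. AE x in M. P t (\<lambda>y. c * f y) x = c * P t f x) \<and>
     (\<forall>t>0. \<forall>f\<in>Lp M 2. \<forall>g\<in>Lp M 2. L2_inner M (P t f) g = L2_inner M f (P t g)) \<and>
     (\<forall>t>0. \<forall>f\<in>Lp M 2. L2_norm M (P t f) \<le> L2_norm M f) \<and>
     (\<forall>s>0. \<forall>t>0. \<forall>f\<in>Lp M 2. AE x in M. P (s + t) f x = P s (P t f) x) \<and>
     (\<forall>f\<in>Lp M 2. ((\<lambda>t. L2_norm M (\<lambda>x. P t f x - f x)) \<longlongrightarrow> 0) (at_right 0))"

text \<open>The graph of the infinitesimal generator of \<open>P\<close>, and the graph of the self-adjoint operator
  \<open>A\<close> of the form: \<open>\<E>(f, h) = - \<langle>A f, h\<rangle>\<close> for all \<open>h\<close> in \<open>F\<close>.\<close>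

definition generator_graph ::
  "'a measure \<Rightarrow> (real \<Rightarrow> ('a \<Rightarrow> real) \<Rightarrow> 'a \<Rightarrow> real) \<Rightarrow> (('a \<Rightarrow> real) \<times> ('a \<Rightarrow> real)) set" where
  "generator_graph M P = {(f, g). f \<in> Lp M 2 \<and> g \<in> Lp M 2 \<and>
     ((\<lambda>t. L2_norm M (\<lambda>x. (P t f x - f x) / t - g x)) \<longlongrightarrow> 0) (at_right 0)}"

definition form_operator_graph ::
  "'a measure \<Rightarrow> (('a \<Rightarrow> real) \<Rightarrow> ('a \<Rightarrow> real) \<Rightarrow> real) \<Rightarrow> ('a \<Rightarrow> real) set
     \<Rightarrow> (('a \<Rightarrow> real) \<times> ('a \<Rightarrow> real)) set" where
  "form_operator_graph M \<E> F = {(f, g). f \<in> F \<and> g \<in> Lp M 2 \<and> (\<forall>h\<in>F. \<E> f h = - L2_inner M g h)}"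

text \<open>By the Hille-Yosida theorem this determines \<open>P\<close> uniquely, up to null sets.\<close>

definition semigroup_of_form ::
  "'a measure \<Rightarrow> (('a \<Rightarrow> real) \<Rightarrow> ('a \<Rightarrow> real) \<Rightarrow> real) \<Rightarrow> ('a \<Rightarrow> real) set
     \<Rightarrow> (real \<Rightarrow> ('a \<Rightarrow> real) \<Rightarrow> 'a \<Rightarrow> real) \<Rightarrow> bool" where
  "semigroup_of_form M \<E> F P \<longleftrightarrow>
     L2_semigroup M P \<and> generator_graph M P = form_operator_graph M \<E> F"

text \<open>\<open>P\<^sub>t 1 = 1\<close>. The constant 1 need not be in \<open>L\<^sup>2\<close>; \<open>P\<^sub>t 1\<close> is the usual extension of \<open>P\<^sub>t\<close> to
  bounded functions, i.e. the a.e. limit of \<open>P\<^sub>t u\<^sub>n\<close> along any sequence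
  \<open>0 \<le> u\<^sub>n\<close> in \<open>L\<^sup>2\<close> increasing to 1.\<close>

definition conservative :: "'a measure \<Rightarrow> (real \<Rightarrow> ('a \<Rightarrow> real) \<Rightarrow> 'a \<Rightarrow> real) \<Rightarrow> bool" where
  "conservative M P \<longleftrightarrow>
     (\<forall>t>0. \<forall>u. (\<forall>n::nat. u n \<in> Lp M 2) \<and>
        (AE x in M. (\<forall>n. 0 \<le> u n x) \<and> incseq (\<lambda>n. u n x) \<and> (\<lambda>n. u n x) \<longlonglongrightarrow> 1) \<longrightarrow>
        (AE x in M. (\<lambda>n. P t (u n) x) \<longlonglongrightarrow> 1))"

text \<open>\<open>k t x y\<close> is the heat kernel \<open>p\<^sub>t(x, y)\<close>.\<close>

definition heat_kernel ::
  "'a measure \<Rightarrow> (real \<Rightarrow> ('a \<Rightarrow> real) \<Rightarrow> 'a \<Rightarrow> real) \<Rightarrow> (real \<Rightarrow> 'a \<Rightarrow> 'a \<Rightarrow> real) \<Rightarrow> bool" where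
  "heat_kernel M P k \<longleftrightarrow>
     (\<forall>t>0. (\<lambda>(x, y). k t x y) \<in> borel_measurable (M \<Otimes>\<^sub>M M) \<and>
        (\<forall>x y. 0 \<le> k t x y) \<and>
        (\<forall>f\<in>Lp M 2. AE x in M.
           integrable M (\<lambda>y. k t x y * f y) \<and> P t f x = (\<integral>y. k t x y * f y \<partial>M)))"

definition ahlfors_regular :: "'a::metric_space measure \<Rightarrow> real \<Rightarrow> bool" where
  "ahlfors_regular M dH \<longleftrightarrow> 0 < dH \<and>
     (\<exists>c1>0. \<exists>c2>0. \<forall>x. \<forall>r>0.
        ennreal (c1 * r powr dH) \<le> emeasure M (ball x r) \<and>
        emeasure M (ball x r) \<le> ennreal (c2 * r powr dH))"

definition sub_gaussian_profile :: "real \<Rightarrow> real \<Rightarrow> real \<Rightarrow> real \<Rightarrow> real \<Rightarrow> real \<Rightarrow> real" where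
  "sub_gaussian_profile dH dW c c' t \<rho> =
     c * t powr (- dH / dW) * exp (- c' * ((\<rho> powr dW) / t) powr (1 / (dW - 1)))"

definition sub_gaussian_estimates ::
  "'a::metric_space measure \<Rightarrow> (real \<Rightarrow> 'a \<Rightarrow> 'a \<Rightarrow> real) \<Rightarrow> real \<Rightarrow> real \<Rightarrow> bool" where
  "sub_gaussian_estimates M k dH dW \<longleftrightarrow>
     (\<exists>c3>0. \<exists>c4>0. \<exists>c5>0. \<exists>c6>0. \<forall>t>0. AE (x, y) in M \<Otimes>\<^sub>M M.
        sub_gaussian_profile dH dW c5 c6 t (dist x y) \<le> k t x y \<and>
        k t x y \<le> sub_gaussian_profile dH dW c3 c4 t (dist x y))"


definition besov_seminorm ::
  "'a measure \<Rightarrow> (real \<Rightarrow> 'a \<Rightarrow> 'a \<Rightarrow> real) \<Rightarrow> real \<Rightarrow> real \<Rightarrow> ('a \<Rightarrow> real) \<Rightarrow> ennreal" where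
  "besov_seminorm M k p \<alpha> f =
     (SUP t\<in>{0<..}. ennreal (t powr - \<alpha>) *
        (\<integral>\<^sup>+ y. (\<integral>\<^sup>+ x. ennreal (\<bar>f x - f y\<bar> powr p * k t x y) \<partial>M) \<partial>M) epowr (1 / p))"

definition besov_space ::
  "'a measure \<Rightarrow> (real \<Rightarrow> 'a \<Rightarrow> 'a \<Rightarrow> real) \<Rightarrow> real \<Rightarrow> real \<Rightarrow> ('a \<Rightarrow> real) set" where
  "besov_space M k p \<alpha> = {f \<in> Lp M p. besov_seminorm M k p \<alpha> f < \<infinity>}"

definition near_diagonal :: "real \<Rightarrow> ('a::metric_space \<times> 'a) set" where
  "near_diagonal r = {(x, y). dist x y < r}"

end

theory Submission
  imports Defs
begin

text \<open>Let \<open>m = \<mu>{|f| \<ge> s/2}\<close> and choose \<open>r\<close> so that the lower bound \<open>c r\<^sup>d\<close> for the volume of balls of radius \<open>r\<close> equals \<open>2 m\<close>.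
  Around every \<open>x\<close> with \<open>|f x| \<ge> s\<close>, a part of \<open>B(x, r)\<close> of measure at least \<open>m\<close> then lies in
  \<open>{|f| < s/2}\<close>, where \<open>|f x - f y| \<ge> s/2\<close>. Integrating over these pairs bounds \<open>\<mu>{|f| \<ge> s}\<close> by
  a power less than one of \<open>\<mu>{|f| \<ge> s/2}\<close>. In terms of \<open>g s = s\<^sup>q \<mu>{|f| \<ge> s}\<close> this reads
  \<open>g s \<le> K (g (s/2))\<^sup>\<theta>\<close> with \<open>\<theta> < 1\<close>, and since \<open>g\<close> is bounded on every interval \<open>(0, T]\<close> by
  Chebyshev's inequality, \<open>g \<le> K powr (1 / (1 - \<theta>))\<close>. For indicator functions a single step gives the
  isoperimetric inequality.\<close>

section \<open>Powers of extended nonnegative numbers\<close>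

lemma epowr_ennreal: "0 \<le> x \<Longrightarrow> ennreal x epowr a = ennreal (x powr a)"
  by (simp add: epowr_def)

lemma epowr_mono:
  assumes "x \<le> y" "0 \<le> a"
  shows "x epowr a \<le> y epowr a"
proof (cases y)
  case (real u)
  with assms(1) obtain v where "x = ennreal v" "0 \<le> v" "v \<le> u"
    by (cases x) (auto simp: top_unique)
  with real assms(2) show ?thesis
    by (simp add: epowr_ennreal powr_mono2 ennreal_leI)
qed (simp add: epowr_def)

section \<open>Separability and measurability near the diagonal\<close>

text \<open>Compact sets are totally bounded, so every ball of integer radius about one base point
  has finite nets of mesh \<open>1 / Suc m\<close>; all these nets together form a countable dense
  set.\<close>

lemma countable_dense_of_compact_closure_balls:
  assumes "\<And>(x::'a::metric_space) r. compact (closure (ball x r))"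
  obtains D :: "'a::metric_space set" where "countable D" "\<And>x e. 0 < e \<Longrightarrow> \<exists>z\<in>D. dist z x < e"
proof -
  fix x0 :: 'a
  have "\<exists>K. finite K \<and> closure (ball x0 (real n)) \<subseteq> (\<Union>z\<in>K. ball z (1 / real (Suc m)))" for n m
  proof -
    have "0 < 1 / real (Suc m)" by simp
    then show ?thesis
      using assms[of x0 "real n"] unfolding compact_eq_totally_bounded by blast
  qed
  then obtain K where K: "\<And>n m. finite (K n m)"
    "\<And>n m. closure (ball x0 (real n)) \<subseteq> (\<Union>z\<in>K n m. ball z (1 / real (Suc m)))"
    by metis
  show thesis
  proof
    show "countable (\<Union>n m. K n m)"
      using K(1) by (simp add: countable_finite)
    fix x :: 'a and e :: real
    assume "0 < e"
    then obtain m where m: "1 / real (Suc m) < e"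
      using nat_approx_posE by metis
    obtain n where "dist x0 x < real n"
      using reals_Archimedean2 by blast
    then have "x \<in> closure (ball x0 (real n))"
      by (intro subsetD[OF closure_subset]) (simp add: mem_ball)
    with K(2)[of n m] obtain z where "z \<in> K n m" "dist z x < 1 / real (Suc m)"
      by (auto simp: mem_ball)
    with m show "\<exists>z\<in>(\<Union>n m. K n m). dist z x < e"
      by force
  qed
qed

text \<open>Separability is essential: without it, the diagonal need not be measurable in the product
  sigma-algebra.\<close>

lemma near_diagonal_measurable:
  fixes D :: "'a::metric_space set"
  assumes "countable D" "\<And>x e. 0 < e \<Longrightarrow> \<exists>z\<in>D. dist z x < e"
  shows "(near_diagonal r :: ('a \<times> 'a) set) \<in> sets (borel \<Otimes>\<^sub>M borel)"
proof -
  have "(near_diagonal r :: ('a \<times> 'a) set) = (\<Union>z\<in>D. \<Union>q\<in>\<rat>. ball z q \<times> ball z (r - q))"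
  proof (intro subset_antisym subsetI)
    fix w :: "'a \<times> 'a"
    assume "w \<in> near_diagonal r"
    then obtain x y where w: "w = (x, y)" "dist x y < r"
      by (auto simp: near_diagonal_def)
    \<comment> \<open>Half of the gap \<open>r - dist x y\<close> is the right scale because
      \<open>q\<close> is paid twice: it bounds \<open>dist z x\<close> and it is subtracted from
      the radius available for \<open>y\<close>.\<close>
    then obtain z where z: "z \<in> D" "dist z x < (r - dist x y) / 2"
      using assms(2)[of "(r - dist x y) / 2" x] by auto
    then obtain q where q: "q \<in> \<rat>" "dist z x < q" "q < (r - dist x y) / 2"
      using Rats_dense_in_real by blast
    have "dist z y \<le> dist z x + dist x y"
      by (rule dist_triangle)
    with q z have "dist z y < r - q"
      by argo
    with w z q show "w \<in> (\<Union>z\<in>D. \<Union>q\<in>\<rat>. ball z q \<times> ball z (r - q))"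
      by (auto simp: mem_ball)
  next
    fix w :: "'a \<times> 'a"
    assume "w \<in> (\<Union>z\<in>D. \<Union>q\<in>\<rat>. ball z q \<times> ball z (r - q))"
    then obtain z q x y where w: "w = (x, y)" "dist z x < q" "dist z y < r - q"
      by (auto simp: mem_ball)
    have "dist x y \<le> dist z x + dist z y"
      by (rule dist_triangle3)
    with w show "w \<in> near_diagonal r"
      by (simp add: near_diagonal_def)
  qed
  also have "\<dots> \<in> sets (borel \<Otimes>\<^sub>M borel)"
    using assms(1) by (intro sets.countable_UN'' countable_rat pair_measureI) auto
  finally show ?thesis .
qed

section \<open>A self-improving halving recursion\<close>

text \<open>Halving maps \<open>(0, T]\<close> into itself, so the supremum \<open>N\<close> of
  \<open>g\<close> there satisfies \<open>N \<le> K * N powr \<theta>\<close>. The bound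
  \<open>G\<close> makes \<open>N\<close> finite, which permits division by
  \<open>N powr \<theta>\<close>; the resulting estimate no longer depends on
  \<open>G\<close>.\<close>

lemma bounded_halving_recursion:
  fixes g :: "real \<Rightarrow> real"
  assumes "0 < T" and \<theta>: "0 < \<theta>" "\<theta> < 1" and "0 \<le> K"
    and bound: "\<And>s. 0 < s \<Longrightarrow> s \<le> T \<Longrightarrow> g s \<le> G"
    and nonneg: "\<And>s. 0 \<le> g s"
    and rec: "\<And>s. 0 < s \<Longrightarrow> s \<le> T \<Longrightarrow> g s \<le> K * g (s / 2) powr \<theta>"
  shows "g T \<le> K powr (1 / (1 - \<theta>))"
proof -
  define N where "N = (SUP s\<in>{0<..T}. g s)"
  have bdd: "bdd_above (g ` {0<..T})"
    using bound by (auto intro!: bdd_aboveI[of _ G])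
  have le_N: "g s \<le> N" if "0 < s" "s \<le> T" for s
    unfolding N_def using that by (intro cSUP_upper bdd) auto
  have "N \<le> K * N powr \<theta>"
    unfolding N_def
  proof (rule cSUP_least)
    fix s assume "s \<in> {0<..T}"
    then have s: "0 < s" "s \<le> T" by auto
    then have "g s \<le> K * g (s / 2) powr \<theta>"
      by (rule rec)
    also have "\<dots> \<le> K * N powr \<theta>"
      using s \<theta> \<open>0 \<le> K\<close> by (intro mult_left_mono powr_mono2 le_N nonneg) auto
    finally show "g s \<le> K * (SUP s\<in>{0<..T}. g s) powr \<theta>"
      by (simp add: N_def)
  qed (use \<open>0 < T\<close> in auto)
  moreover have "0 \<le> N"
    using le_N[of T] nonneg[of T] \<open>0 < T\<close> by auto
  ultimately have "N \<le> K powr (1 / (1 - \<theta>))"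
  proof (cases "N = 0")
    case False
    with \<open>0 \<le> N\<close> have "0 < N" by simp
    have "N = N powr (1 - \<theta>) * N powr \<theta>"
      using \<open>0 < N\<close> by (simp flip: powr_add)
    with \<open>N \<le> K * N powr \<theta>\<close> have "N powr (1 - \<theta>) * N powr \<theta> \<le> K * N powr \<theta>"
      by simp
    then have "N powr (1 - \<theta>) \<le> K"
      using \<open>0 < N\<close> by simp
    then have "(N powr (1 - \<theta>)) powr (1 / (1 - \<theta>)) \<le> K powr (1 / (1 - \<theta>))"
      using \<theta> by (intro powr_mono2) auto
    then show ?thesis
      using \<theta> \<open>0 < N\<close> by (simp add: powr_powr)
  qed simp
  with le_N[of T] \<open>0 < T\<close> show ?thesis
    by simp
qed

section \<open>Metric measure spaces with a lower volume bound\<close>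

locale volume_lower_bound =
  fixes M :: "'a::metric_space measure" and c d :: real
  assumes sets_M: "sets M = sets borel"
    and compact_finite: "\<And>K. compact K \<Longrightarrow> emeasure M K < \<infinity>"
    and compact_closure_ball: "\<And>(x::'a) r. compact (closure (ball x r))"
    and c_pos: "0 < c" and d_pos: "0 < d"
    and volume: "\<And>x r. 0 < r \<Longrightarrow> ennreal (c * r powr d) \<le> emeasure M (ball x r)"
begin

lemma space_M: "space M = UNIV"
  using sets_eq_imp_space_eq[OF sets_M] by simp

lemma near_diagonal_sets: "near_diagonal r \<in> sets (M \<Otimes>\<^sub>M M)"
proof -
  obtain D :: "'a set" where "countable D" "\<And>x e. 0 < e \<Longrightarrow> \<exists>z\<in>D. dist z x < e"
    using countable_dense_of_compact_closure_balls[OF compact_closure_ball] by blast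
  from near_diagonal_measurable[OF this] show ?thesis
    using sets_pair_measure_cong[OF sets_M sets_M] by simp
qed

text \<open>Allows product measures to be computed by slices. The closures of balls of integer
  radius about one point are compact, hence of finite measure, and exhaust the space.\<close>

sublocale sigma_finite_measure M
proof
  fix x0 :: 'a
  show "\<exists>A. countable A \<and> A \<subseteq> sets M \<and> \<Union>A = space M \<and> (\<forall>a\<in>A. emeasure M a \<noteq> \<infinity>)"
  proof (intro exI conjI ballI)
    let ?A = "range (\<lambda>n::nat. closure (ball x0 (real n)))"
    show "countable ?A" by simp
    show "?A \<subseteq> sets M" by (auto simp: sets_M)
    show "\<Union>?A = space M"
    proof -
      have "\<exists>n::nat. x \<in> closure (ball x0 (real n))" for x
        using reals_Archimedean2[of "dist x0 x"] closure_subset[of "ball x0 _"]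
        by (meson mem_ball subsetD)
      then show ?thesis by (auto simp: space_M)
    qed
    show "emeasure M a \<noteq> \<infinity>" if "a \<in> ?A" for a
      using that compact_finite[OF compact_closure_ball] by (auto simp: less_top)
  qed
qed

section \<open>Counting close pairs between a set and a complement\<close>

lemma separated_pairs_sets:
  assumes "A \<in> sets M" "B \<in> sets M"
  shows "{(x, y). x \<in> A \<and> y \<in> - B \<and> dist x y < r} \<in> sets (M \<Otimes>\<^sub>M M)"
proof -
  have "{(x, y). x \<in> A \<and> y \<in> - B \<and> dist x y < r} = (A \<times> (space M - B)) \<inter> near_diagonal r"
    by (auto simp: near_diagonal_def space_M)
  then show ?thesis
    using assms near_diagonal_sets by auto
qed

text \<open>The radius is chosen so that every ball has measure at least \<open>2 * m\<close>;
  removing \<open>B\<close> costs at most \<open>m\<close>. Each \<open>x\<close> in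
  \<open>A\<close> thus sees mass at least \<open>m\<close> outside \<open>B\<close>, and
  integrating the slices over \<open>A\<close> gives the product.\<close>

lemma separated_pairs_measure:
  assumes A: "A \<in> sets M" and B: "B \<in> sets M" "emeasure M B = ennreal m" and m: "0 < m"
    and r: "r = (2 * m / c) powr (1 / d)"
  shows "emeasure M A * ennreal m
    \<le> emeasure (M \<Otimes>\<^sub>M M) {(x, y). x \<in> A \<and> y \<in> - B \<and> dist x y < r}"
proof -
  let ?W = "{(x, y). x \<in> A \<and> y \<in> - B \<and> dist x y < r}"
  have "0 < r" and crd: "c * r powr d = 2 * m"
    using m c_pos d_pos by (auto simp: r powr_powr)
  have slice: "ennreal m \<le> emeasure M (ball x r - B)" for x
  proof -
    have "ennreal (2 * m) \<le> emeasure M (ball x r)"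
      using volume[OF \<open>0 < r\<close>, of x] crd by simp
    also have "\<dots> \<le> emeasure M ((ball x r - B) \<union> B)"
      using B(1) by (intro emeasure_mono) (auto simp: sets_M)
    also have "\<dots> \<le> emeasure M (ball x r - B) + ennreal m"
      unfolding B(2)[symmetric] using B(1) by (intro emeasure_subadditive) (auto simp: sets_M)
    \<comment> \<open>Writing \<open>2 * m\<close> as a sum lets the finite summand \<open>m\<close>
      cancel.\<close>
    finally have "ennreal m + ennreal m \<le> emeasure M (ball x r - B) + ennreal m"
      using m by (simp flip: ennreal_plus)
    then show ?thesis
      by simp
  qed
  have "emeasure M A * ennreal m = (\<integral>\<^sup>+ x. ennreal m * indicator A x \<partial>M)"
    using A by (simp add: nn_integral_cmult_indicator mult.commute)
  also have "\<dots> \<le> (\<integral>\<^sup>+ x. emeasure M (Pair x -` ?W) \<partial>M)"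
  proof (rule nn_integral_mono)
    fix x
    have "Pair x -` ?W = (if x \<in> A then ball x r - B else {})"
      by (auto simp: mem_ball)
    with slice[of x] show "ennreal m * indicator A x \<le> emeasure M (Pair x -` ?W)"
      by auto
  qed
  also have "\<dots> = emeasure (M \<Otimes>\<^sub>M M) ?W"
    using separated_pairs_sets[OF A B(1)] by (simp add: emeasure_pair_measure_alt)
  finally show ?thesis .
qed

section \<open>Isoperimetric inequality\<close>

text \<open>A single radius suffices: with \<open>A = B = E\<close> the pair count is at least
  \<open>m * m\<close>, and \<open>r powr (\<delta> + d)\<close> is a constant times
  \<open>m powr (1 + \<delta> / d)\<close>, so the quotient is a multiple of
  \<open>m powr (1 - \<delta> / d)\<close>.\<close>

lemma isoperimetric:
  assumes E: "E \<in> sets M" "emeasure M E < \<infinity>"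
  shows "emeasure M E epowr ((d - \<delta>) / d)
    \<le> ennreal ((2 / c) powr ((\<delta> + d) / d)) *
       (SUP r\<in>{0<..}. ennreal (1 / r powr (\<delta> + d)) *
          emeasure (M \<Otimes>\<^sub>M M) {(x, y). x \<in> E \<and> y \<in> - E \<and> dist x y < r})"
    (is "_ \<le> _ * ?S")
proof -
  obtain m where m: "emeasure M E = ennreal m" "0 \<le> m"
    using E(2) by (cases "emeasure M E") auto
  show ?thesis
  proof (cases "m = 0")
    \<comment> \<open>Here the left side vanishes, since \<open>0 powr x = 0\<close> for every
      \<open>x\<close>.\<close>
    case True
    then show ?thesis by (simp add: m epowr_def)
  next
    case False
    with m have "0 < m" by simp
    define r where "r = (2 * m / c) powr (1 / d)"
    have "0 < r"
      using \<open>0 < m\<close> c_pos by (simp add: r_def)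
    have r_powr: "r powr (\<delta> + d) = (2 / c) powr ((\<delta> + d) / d) * m powr ((\<delta> + d) / d)"
      using \<open>0 < m\<close> c_pos by (simp add: r_def powr_powr flip: powr_mult)
    have m_powr: "m powr ((d - \<delta>) / d) * m powr ((\<delta> + d) / d) = m * m"
      using \<open>0 < m\<close> d_pos
      by (simp add: add_divide_distrib diff_divide_distrib powr_mult_base flip: powr_add power2_eq_square)
    have "m powr ((d - \<delta>) / d) = (2 / c) powr ((\<delta> + d) / d) * (1 / r powr (\<delta> + d) * (m * m))"
      unfolding r_powr using \<open>0 < m\<close> c_pos by (simp flip: m_powr)
    then have "emeasure M E epowr ((d - \<delta>) / d)
        = ennreal ((2 / c) powr ((\<delta> + d) / d)) *
            (ennreal (1 / r powr (\<delta> + d)) * (emeasure M E * ennreal m))"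
      using m by (simp add: epowr_ennreal flip: ennreal_mult)
    also have "\<dots> \<le> ennreal ((2 / c) powr ((\<delta> + d) / d)) * ?S"
      using separated_pairs_measure[OF E(1) E(1) m(1) \<open>0 < m\<close> r_def] \<open>0 < r\<close>
      by (intro mult_left_mono SUP_upper2[of r]) auto
    finally show ?thesis .
  qed
qed

section \<open>Level sets and the weak Sobolev inequality\<close>

text \<open>Pairs joining the level set at \<open>s\<close> to the complement of the one at
  \<open>s / 2\<close> have \<open>\<bar>f x - f y\<bar> \<ge> s / 2\<close>, and
  \<open>separated_pairs_measure\<close> bounds their mass from below.\<close>

lemma level_set_difference_bound:
  fixes f :: "'a \<Rightarrow> real"
  assumes f: "f \<in> borel_measurable M" and "0 < s" "0 < p"
    and m: "emeasure M {x \<in> space M. s / 2 \<le> \<bar>f x\<bar>} = ennreal m" "0 < m"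
    and r: "r = (2 * m / c) powr (1 / d)"
  shows "ennreal ((s / 2) powr p) * (emeasure M {x \<in> space M. s \<le> \<bar>f x\<bar>} * ennreal m)
    \<le> (\<integral>\<^sup>+ (x, y) \<in> near_diagonal r. ennreal (\<bar>f x - f y\<bar> powr p) \<partial>(M \<Otimes>\<^sub>M M))"
proof -
  define L where "L t = {x \<in> space M. t \<le> \<bar>f x\<bar>}" for t
  have L: "L t \<in> sets M" for t
    unfolding L_def using f by measurable
  let ?W = "{(x, y). x \<in> L s \<and> y \<in> - L (s / 2) \<and> dist x y < r}"
  have "ennreal ((s / 2) powr p) * (emeasure M (L s) * ennreal m)
      \<le> ennreal ((s / 2) powr p) * emeasure (M \<Otimes>\<^sub>M M) ?W"
    using m r by (intro mult_left_mono separated_pairs_measure L) (auto simp: L_def)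
  also have "\<dots> = (\<integral>\<^sup>+ w. ennreal ((s / 2) powr p) * indicator ?W w \<partial>(M \<Otimes>\<^sub>M M))"
    using separated_pairs_sets[OF L L] by (simp add: nn_integral_cmult_indicator)
  also have "\<dots> \<le> (\<integral>\<^sup>+ (x, y) \<in> near_diagonal r. ennreal (\<bar>f x - f y\<bar> powr p) \<partial>(M \<Otimes>\<^sub>M M))"
  proof (rule nn_integral_mono)
    fix w :: "'a \<times> 'a"
    obtain x y where w: "w = (x, y)" by (cases w)
    have "(s / 2) powr p \<le> \<bar>f x - f y\<bar> powr p" if "x \<in> L s" "y \<notin> L (s / 2)"
    proof -
      have "s \<le> \<bar>f x\<bar>" "\<bar>f y\<bar> < s / 2"
        using that by (auto simp: L_def space_M)
      then have "s / 2 \<le> \<bar>f x - f y\<bar>"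
        by linarith
      then show ?thesis
        using \<open>0 < s\<close> \<open>0 < p\<close> by (intro powr_mono2) auto
    qed
    then show "ennreal ((s / 2) powr p) * indicator ?W w
      \<le> (case w of (x, y) \<Rightarrow> ennreal (\<bar>f x - f y\<bar> powr p)) * indicator (near_diagonal r) w"
      by (auto simp: w near_diagonal_def indicator_def ennreal_leI)
  qed
  finally show ?thesis
    by (simp add: L_def)
qed

text \<open>The supremum is tested at the radius with \<open>c * r powr d = 2 * m\<close>. There the
  normalising factor, raised to the power \<open>p\<close>, is
  \<open>(2 * m / c) powr (1 + p * \<delta> / d)\<close>; one factor \<open>m\<close> cancels
  against the pair count, leaving the exponent \<open>p * \<delta> / d\<close>.\<close>

lemma level_set_recursion:
  fixes f :: "'a \<Rightarrow> real"
  assumes f: "f \<in> borel_measurable M" and "0 < s" "0 < p"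
    and a: "emeasure M {x \<in> space M. s \<le> \<bar>f x\<bar>} = ennreal a" "0 \<le> a"
    and m: "emeasure M {x \<in> space M. s / 2 \<le> \<bar>f x\<bar>} = ennreal m" "0 \<le> m"
    and S: "(SUP r\<in>{0<..}. ennreal (1 / r powr (\<delta> + d / p)) *
       (\<integral>\<^sup>+ (x, y) \<in> near_diagonal r. ennreal (\<bar>f x - f y\<bar> powr p) \<partial>(M \<Otimes>\<^sub>M M)) epowr (1 / p))
       \<le> ennreal S" "0 \<le> S"
  shows "a \<le> (2 / s) powr p * (2 / c) powr (1 + p * \<delta> / d) * S powr p * m powr (p * \<delta> / d)"
proof (cases "m = 0")
  \<comment> \<open>The chosen radius would be zero here; instead, monotonicity of level sets forces
    \<open>a = 0\<close>.\<close>
  case True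
  have "emeasure M {x \<in> space M. s \<le> \<bar>f x\<bar>} \<le> emeasure M {x \<in> space M. s / 2 \<le> \<bar>f x\<bar>}"
    using f \<open>0 < s\<close> by (intro emeasure_mono) auto
  with True a m show ?thesis by simp
next
  case False
  with m have "0 < m" by simp
  define r where "r = (2 * m / c) powr (1 / d)"
  have "0 < r"
    using \<open>0 < m\<close> c_pos by (simp add: r_def)
  let ?J = "(s / 2) powr p * (a * m)" and ?R = "r powr (\<delta> + d / p)"
  have "ennreal ?J
      \<le> (\<integral>\<^sup>+ (x, y) \<in> near_diagonal r. ennreal (\<bar>f x - f y\<bar> powr p) \<partial>(M \<Otimes>\<^sub>M M))"
    using level_set_difference_bound[OF f \<open>0 < s\<close> \<open>0 < p\<close> m(1) \<open>0 < m\<close> r_def] a m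
    by (simp add: ennreal_mult)
  then have "ennreal ?J epowr (1 / p)
      \<le> (\<integral>\<^sup>+ (x, y) \<in> near_diagonal r. ennreal (\<bar>f x - f y\<bar> powr p) \<partial>(M \<Otimes>\<^sub>M M)) epowr (1 / p)"
    using \<open>0 < p\<close> by (intro epowr_mono) auto
  then have "ennreal (1 / ?R) * ennreal ?J epowr (1 / p) \<le> ennreal S"
    using \<open>0 < r\<close> by (intro order_trans[OF SUP_upper2 S(1), of r] mult_left_mono) auto
  then have "1 / ?R * ?J powr (1 / p) \<le> S"
    using a m S(2) by (simp add: epowr_ennreal flip: ennreal_mult)
  then have "?J powr (1 / p) \<le> S * ?R"
    using \<open>0 < r\<close> by (simp add: field_simps)
  then have "(?J powr (1 / p)) powr p \<le> (S * ?R) powr p"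
    using \<open>0 < p\<close> by (intro powr_mono2) auto
  then have "?J \<le> S powr p * ?R powr p"
    using \<open>0 < p\<close> a m S(2) by (simp add: powr_powr powr_mult[of S])
  also have "?R powr p = (2 * m / c) powr (1 + p * \<delta> / d)"
  proof -
    have "(1 / d) * ((\<delta> + d / p) * p) = 1 + p * \<delta> / d"
      using \<open>0 < p\<close> d_pos by (simp add: field_simps)
    then show ?thesis
      by (simp only: r_def powr_powr mult.assoc)
  qed
  \<comment> \<open>The factor \<open>m\<close> is split off so that it cancels against the one in
    \<open>?J\<close>.\<close>
  also have "\<dots> = (2 / c) powr (1 + p * \<delta> / d) * m powr (p * \<delta> / d) * m"
    using \<open>0 < m\<close> c_pos by (simp add: powr_add powr_mult powr_divide)
  finally have "(s / 2) powr p * a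
      \<le> S powr p * ((2 / c) powr (1 + p * \<delta> / d) * m powr (p * \<delta> / d))"
    using \<open>0 < m\<close> by (simp flip: mult.assoc)
  then have "(2 / s) powr p * ((s / 2) powr p * a)
      \<le> (2 / s) powr p * (S powr p * ((2 / c) powr (1 + p * \<delta> / d) * m powr (p * \<delta> / d)))"
    by (intro mult_left_mono) auto
  moreover have "(2 / s) powr p * ((s / 2) powr p * a) = a"
    using \<open>0 < s\<close> by (simp flip: powr_mult mult.assoc)
  ultimately show ?thesis
    by (simp only: mult_ac)
qed

text \<open>The exponent \<open>q\<close> is the one that makes \<open>t powr q * a t\<close> scale
  correctly under the level set recursion with \<open>\<theta> = p * \<delta> / d\<close>, that is,
  \<open>q * (1 - \<theta>) = p\<close>.\<close>

lemma weak_sobolev: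
  fixes f :: "'a \<Rightarrow> real"
  assumes f: "f \<in> Lp M p" and "0 < \<delta>" "0 < p" "p * \<delta> < d"
    and q: "q = p * d / (d - p * \<delta>)" and "0 \<le> s"
  shows "ennreal s * emeasure M {x \<in> space M. s \<le> \<bar>f x\<bar>} epowr (1 / q)
    \<le> ennreal ((2 powr q * (2 / c) powr (1 + p * \<delta> / d)) powr (1 / p)) *
       (SUP r\<in>{0<..}. ennreal (1 / r powr (\<delta> + d / p)) *
          (\<integral>\<^sup>+ (x, y) \<in> near_diagonal r. ennreal (\<bar>f x - f y\<bar> powr p) \<partial>(M \<Otimes>\<^sub>M M)) epowr (1 / p))"
    (is "_ \<le> ennreal (?K powr (1 / p)) * ?S")
proof (cases "s = 0 \<or> ?S = \<infinity>")
  \<comment> \<open>If \<open>s = 0\<close> the left side is zero; if the supremum is infinite so is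
    the right side, as its constant is positive.\<close>
  case True
  have "0 < ?K powr (1 / p)"
    using c_pos by simp
  then have "ennreal (?K powr (1 / p)) * \<infinity> = \<infinity>"
    by (simp add: ennreal_mult_top)
  with True show ?thesis
    by (elim disjE) (simp_all only: top_greatest infinity_ennreal_def, simp)
next
  case False
  with \<open>0 \<le> s\<close> have "0 < s" by simp
  from False obtain S where S: "?S = ennreal S" "0 \<le> S"
    by (cases ?S) auto
  define \<theta> where "\<theta> = p * \<delta> / d"
  have \<theta>: "0 < \<theta>" "\<theta> < 1"
    using assms d_pos by (auto simp: \<theta>_def)
  have q\<theta>: "q * (1 - \<theta>) = p"
    using assms d_pos by (simp add: \<theta>_def field_simps)
  then have "q * \<theta> = q - p"
    by (simp add: algebra_simps)
  have "0 < q"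
    using assms d_pos by simp
  with \<theta> \<open>q * \<theta> = q - p\<close> have "p \<le> q"
    using mult_pos_pos[of q \<theta>] by linarith
  have meas: "f \<in> borel_measurable M" and int: "integrable M (\<lambda>x. \<bar>f x\<bar> powr p)"
    using f by (auto simp: Lp_def)
  define I where "I = (\<integral>x. \<bar>f x\<bar> powr p \<partial>M)"
  define a where "a t = measure M {x \<in> space M. t \<le> \<bar>f x\<bar>}" for t
  \<comment> \<open>Chebyshev's inequality, which also gives finiteness: \<open>measure\<close>
    returns 0 on sets of infinite measure, so the equality with \<open>ennreal (a t)\<close>
    requires it.\<close>
  have level: "emeasure M {x \<in> space M. t \<le> \<bar>f x\<bar>} = ennreal (a t) \<and> a t \<le> I / t powr p"
    if "0 < t" for t
  proof -
    have eq: "{x \<in> space M. t \<le> \<bar>f x\<bar>} = {x \<in> space M. t powr p \<le> \<bar>f x\<bar> powr p}"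
    proof -
      have "t \<le> u \<longleftrightarrow> t powr p \<le> u powr p" if "0 \<le> u" for u
        using that \<open>0 < t\<close> \<open>0 < p\<close> powr_mono2[of p t u] powr_less_mono2[of p u t]
        by linarith
      then show ?thesis by simp
    qed
    have "0 < t powr p" using that by simp
    then have "emeasure M {x \<in> space M. t powr p \<le> \<bar>f x\<bar> powr p} \<le> ennreal (1 / t powr p * I)"
      unfolding I_def by (intro integral_Markov_inequality[OF int]) auto
    moreover from this
    have "emeasure M {x \<in> space M. t \<le> \<bar>f x\<bar>} = ennreal (a t)"
      unfolding a_def by (intro emeasure_eq_ennreal_measure) (auto simp: eq top_unique)
    moreover have "0 \<le> I" by (simp add: I_def)
    ultimately show ?thesis
      by (simp add: eq ennreal_le_iff)
  qed
  define g where "g t = t powr q * a t" for t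
  have "g s \<le> (?K * S powr p) powr (1 / (1 - \<theta>))"
  proof (rule bounded_halving_recursion[OF \<open>0 < s\<close> \<theta>])
    show "0 \<le> ?K * S powr p"
      using c_pos by simp
    show "0 \<le> g t" for t
      by (simp add: g_def a_def)
    fix t :: real
    assume t: "0 < t" "t \<le> s"
    \<comment> \<open>Since \<open>p \<le> q\<close>, the Chebyshev bound is largest at
      \<open>t = s\<close>. It depends on \<open>f\<close> and \<open>s\<close>, but serves as the
      bound \<open>G\<close> of the halving lemma and so does not enter the final constant.\<close>
    have "g t \<le> t powr q * (I / t powr p)"
      unfolding g_def using level t by (intro mult_left_mono) auto
    also have "\<dots> = t powr (q - p) * I"
      by (simp add: powr_diff)
    also have "\<dots> \<le> s powr (q - p) * I"
      using t \<open>p \<le> q\<close> by (intro mult_right_mono powr_mono2) (auto simp: I_def)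
    finally show "g t \<le> s powr (q - p) * I" .
    have "a t \<le> (2 / t) powr p * (2 / c) powr (1 + \<theta>) * S powr p * a (t / 2) powr \<theta>"
      unfolding \<theta>_def
      using t S level[of t] level[of "t / 2"]
      by (intro level_set_recursion[OF meas t(1) \<open>0 < p\<close>]) (auto simp: a_def)
    then have "g t \<le> t powr q *
        ((2 / t) powr p * (2 / c) powr (1 + \<theta>) * S powr p * a (t / 2) powr \<theta>)"
      unfolding g_def by (intro mult_left_mono) auto
    also have "\<dots> = ?K * S powr p * g (t / 2) powr \<theta>"
    proof -
      \<comment> \<open>By \<open>q * \<theta> = q - p\<close> the remaining power of
        \<open>t\<close> is exactly the one inside \<open>g (t / 2) powr \<theta>\<close>; the
        powers of 2 collect to \<open>2 powr q\<close>.\<close>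
      have "t powr q * (2 / t) powr p = t powr (q - p) * 2 powr p"
        using t by (simp add: powr_divide powr_diff)
      also have "\<dots> = (t / 2) powr (q * \<theta>) * (2 powr (q * \<theta>) * 2 powr p)"
        using t by (simp add: powr_divide \<open>q * \<theta> = q - p\<close>)
      also have "2 powr (q * \<theta>) * 2 powr p = (2::real) powr q"
        by (simp add: \<open>q * \<theta> = q - p\<close> flip: powr_add)
      finally have "t powr q * (2 / t) powr p = (t / 2) powr (q * \<theta>) * 2 powr q" .
      then show ?thesis
        using t by (simp add: g_def a_def powr_mult powr_powr \<theta>_def flip: mult.assoc)
    qed
    finally show "g t \<le> ?K * S powr p * g (t / 2) powr \<theta>" .
  qed
  then have "g s powr (1 / q) \<le> ((?K * S powr p) powr (1 / (1 - \<theta>))) powr (1 / q)"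
    using \<open>0 < q\<close> by (intro powr_mono2) (auto simp: g_def a_def)
  \<comment> \<open>The two roots combine through \<open>(1 - \<theta>) * q = p\<close>, so that
    \<open>S\<close> will appear to the first power.\<close>
  also have "\<dots> = (?K * S powr p) powr (1 / p)"
    by (simp add: powr_powr mult.commute flip: q\<theta>)
  also have "\<dots> = ?K powr (1 / p) * S"
    using \<open>0 < p\<close> S c_pos by (simp add: powr_mult powr_powr)
  also have "g s powr (1 / q) = s * a s powr (1 / q)"
    using \<open>0 < s\<close> \<open>0 < q\<close> by (simp add: g_def a_def powr_mult powr_powr)
  finally show ?thesis
    using level[OF \<open>0 < s\<close>] \<open>0 < s\<close> S
    by (simp add: epowr_ennreal a_def ennreal_leI flip: ennreal_mult)
qed

end

section \<open>Application to Ahlfors regular Dirichlet spaces\<close>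

theorem corollary0p17:
  fixes M :: "'a::metric_space measure"
    and \<E> :: "('a \<Rightarrow> real) \<Rightarrow> ('a \<Rightarrow> real) \<Rightarrow> real"
    and F :: "('a \<Rightarrow> real) set"
    and P :: "real \<Rightarrow> ('a \<Rightarrow> real) \<Rightarrow> 'a \<Rightarrow> real"
    and k :: "real \<Rightarrow> 'a \<Rightarrow> 'a \<Rightarrow> real"
    and dH dW :: real
  assumes "radon_measure M"
    and "\<And>(x::'a) r. compact (closure (ball x r))"
    and "symmetric_dirichlet_form M \<E> F"
    and "semigroup_of_form M \<E> F P"
    and "ahlfors_regular M dH"
    and "conservative M P"
    and "heat_kernel M P k"
    and "1 < dW"
    and "sub_gaussian_estimates M k dH dW"
  shows
    "(\<forall>\<delta> p. 0 < \<delta> \<and> \<delta> < dH \<and> 1 \<le> p \<and> p < dH / \<delta> \<longrightarrow>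
        (\<exists>C>0::real. \<forall>f \<in> besov_space M k p (\<delta> / dW).
           (SUP s\<in>{0..}. ennreal s *
              emeasure M {x \<in> space M. s \<le> \<bar>f x\<bar>} epowr (1 / (p * dH / (dH - p * \<delta>))))
           \<le> ennreal C *
              (SUP r\<in>{0<..}. ennreal (1 / r powr (\<delta> + dH / p)) *
                 (\<integral>\<^sup>+ (x, y) \<in> near_diagonal r. ennreal (\<bar>f x - f y\<bar> powr p) \<partial>(M \<Otimes>\<^sub>M M))
                   epowr (1 / p))))
   \<and> (\<forall>\<delta>. 0 < \<delta> \<and> \<delta> < dH \<longrightarrow>
        (\<exists>C>0::real. \<forall>E \<in> sets M. emeasure M E < \<infinity> \<longrightarrow>
           emeasure M E epowr ((dH - \<delta>) / dH)
           \<le> ennreal C *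
              (SUP r\<in>{0<..}. ennreal (1 / r powr (\<delta> + dH)) *
                 emeasure (M \<Otimes>\<^sub>M M) {(x, y). x \<in> E \<and> y \<in> - E \<and> dist x y < r})))"
proof -
  obtain c where c: "0 < c" "\<And>x r. 0 < r \<Longrightarrow> ennreal (c * r powr dH) \<le> emeasure M (ball x r)"
    and "0 < dH"
    using assms(5) unfolding ahlfors_regular_def by blast
  interpret volume_lower_bound M c dH
    using assms(1,2) c \<open>0 < dH\<close> by unfold_locales (auto simp: radon_measure_def)
  show ?thesis
  proof (intro conjI allI impI)
    fix \<delta> p
    assume *: "0 < \<delta> \<and> \<delta> < dH \<and> 1 \<le> p \<and> p < dH / \<delta>"
    \<comment> \<open>This makes \<open>q\<close> positive and the recursion exponent
      \<open>p * \<delta> / dH\<close> less than one.\<close>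
    then have "p * \<delta> < dH"
      by (simp add: less_divide_eq)
    with * show "\<exists>C>0::real. \<forall>f \<in> besov_space M k p (\<delta> / dW).
        (SUP s\<in>{0..}. ennreal s *
           emeasure M {x \<in> space M. s \<le> \<bar>f x\<bar>} epowr (1 / (p * dH / (dH - p * \<delta>))))
        \<le> ennreal C *
           (SUP r\<in>{0<..}. ennreal (1 / r powr (\<delta> + dH / p)) *
              (\<integral>\<^sup>+ (x, y) \<in> near_diagonal r. ennreal (\<bar>f x - f y\<bar> powr p) \<partial>(M \<Otimes>\<^sub>M M))
                epowr (1 / p))"
      using c(1)
      \<comment> \<open>The witness depends only on \<open>p\<close>, \<open>\<delta>\<close>,
        \<open>dH\<close> and the volume constant \<open>c\<close>, so it is uniform in
        \<open>f\<close>; membership in \<open>besov_space\<close> supplies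
        \<open>f \<in> Lp M p\<close>.\<close>
      by (intro exI[of _ "(2 powr (p * dH / (dH - p * \<delta>)) * (2 / c) powr (1 + p * \<delta> / dH)) powr (1 / p)"]
            conjI ballI SUP_least weak_sobolev) (auto simp: besov_space_def)
  next
    fix \<delta> assume "0 < \<delta> \<and> \<delta> < dH"
    show "\<exists>C>0::real. \<forall>E \<in> sets M. emeasure M E < \<infinity> \<longrightarrow>
        emeasure M E epowr ((dH - \<delta>) / dH)
        \<le> ennreal C *
           (SUP r\<in>{0<..}. ennreal (1 / r powr (\<delta> + dH)) *
              emeasure (M \<Otimes>\<^sub>M M) {(x, y). x \<in> E \<and> y \<in> - E \<and> dist x y < r})"
      using c(1)
      by (intro exI[of _ "(2 / c) powr ((\<delta> + dH) / dH)"] conjI ballI impI isoperimetric) auto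
  qed
qed

end
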